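(* Let $m\ge n$ and let $F(x_1,\dots,x_m,z):\mathbb R^{m+1}\to\mathbb R^n$ be a smooth function with $F(\vec0)=\vec0$. Suppose that the Jacobian matrix $J=\left(\frac{\partial}{\partial x_j}F_i(\vec0)\right)_{i\in[n],j\in[m]}$ has rank $n-1$. Let $w\in\mathbb R^n$ be any non-zero vector in $\operatorname{Ker}J^T$ and let $F^w:\mathbb R^m\to\mathbb R$ be $F^w(x_1,\dots,x_m)=\sum_{i\in[n]}w_iF_i(x_1,\dots,x_m,0)$. Let $R:\mathbb R^{m-(n-1)}\to\operatorname{Ker}J$ be a linear isomorphism and let $G:\mathbb R^{m-(n-1)}\to\mathbb R$ be $G(y)=F^w(R(y))$. If the Hessian matrix $H=\left(\frac{\partial^2}{\partial y_i\partial y_j}G(\vec0)\right)_{i,j\in[m-(n-1)]}$ has both a positive eigenvalue and a negative eigenvalue, then there exist $\varepsilon_0>0$ and a function $g:[-\varepsilon_0,\varepsilon_0]\to\mathbb R^m$ such that $F(g(z),z)=\vec0$ for all $z\in[-\varepsilon_0,\varepsilon_0]$. *)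

theory Defs
  imports "HOL-Analysis.Analysis"
begin

fun C_times_diff :: "nat \<Rightarrow> ('a::euclidean_space \<Rightarrow> 'b::euclidean_space) \<Rightarrow> bool" where
  "C_times_diff 0 f \<longleftrightarrow> continuous_on UNIV f"
| "C_times_diff (Suc k) f \<longleftrightarrow>
     (\<forall>x. f differentiable (at x)) \<and>
     (\<forall>v. C_times_diff k (\<lambda>x. frechet_derivative f (at x) v))"

definition smooth :: "('a::euclidean_space \<Rightarrow> 'b::euclidean_space) \<Rightarrow> bool" where
  "smooth f \<longleftrightarrow> (\<forall>k. C_times_diff k f)"

definition partial_deriv :: "'m::finite \<Rightarrow> (real ^ 'm \<Rightarrow> real) \<Rightarrow> real ^ 'm \<Rightarrow> real" where
  "partial_deriv j f x = deriv (\<lambda>t. f (x + t *\<^sub>R axis j 1)) 0"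

definition hessian :: "(real ^ 'm::finite \<Rightarrow> real) \<Rightarrow> real ^ 'm \<Rightarrow> real ^ 'm ^ 'm" where
  "hessian f x = (\<chi> i j. partial_deriv i (partial_deriv j f) x)"

definition matrix_kernel :: "real ^ 'm ^ 'n \<Rightarrow> (real ^ 'm) set" where
  "matrix_kernel A = {x. A *v x = 0}"

definition is_eigenvalue :: "real ^ 'k ^ 'k \<Rightarrow> real \<Rightarrow> bool" where
  "is_eigenvalue A c \<longleftrightarrow> (\<exists>v. v \<noteq> 0 \<and> A *v v = c *\<^sub>R v)"

end

theory Submission
  imports Defs
begin

text \<open>
  Let \<open>B\<close> be the second derivative of \<open>F\<close> at the origin. Since the form \<open>w \<bullet> B x x\<close> is indefinite on
  the kernel of \<open>J\<close>, there are \<open>y\<close> and \<open>v\<close> in the kernel such that \<open>w \<bullet> B (y + t v) (y + t v)\<close> has a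
  simple zero at \<open>t = 0\<close>. Substitute \<open>x = s (y + t v) + s\<^sup>2 u\<close> and \<open>z = s\<^sup>3\<close>. Then \<open>F (x, z) / s\<^sup>2\<close>
  converges, locally uniformly in \<open>(t, u)\<close> as \<open>s \<longlongrightarrow> 0\<close>, to \<open>J u + B (y + t v) (y + t v) / 2\<close>. As the
  range of \<open>J\<close> is the hyperplane orthogonal to \<open>w\<close>, this limit vanishes for \<open>t = 0\<close> and a suitable \<open>u\<close>,
  and its derivative there is onto. By Brouwer's fixed point theorem such a zero survives small
  continuous perturbations, so \<open>F (x, s\<^sup>3) = 0\<close> is solvable for all small \<open>s\<close> of either sign.
\<close>

section \<open>Second-order Taylor expansion at the origin\<close>

text \<open>Differentiability of \<open>f'\<close> at 0 is given for each direction \<open>h\<close>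
  separately. Summing over the basis makes the estimate uniform in \<open>h\<close>, and the mean
  value inequality along the segment from 0 to \<open>p\<close> turns it into a bound on the
  remainder.\<close>

lemma second_order_taylor_at_0:
  fixes f :: "'a::euclidean_space \<Rightarrow> 'b::euclidean_space"
  assumes f': "\<And>x. (f has_derivative f' x) (at x)"
    and f'': "\<And>h. ((\<lambda>x. f' x h) has_derivative (\<lambda>k. B k h)) (at 0)"
    and lin: "\<And>k. linear (B k)"
    and e: "e > 0"
  shows "\<exists>d>0. \<forall>p. norm p < d \<longrightarrow>
    norm (f p - f 0 - f' 0 p - (1/2) *\<^sub>R B p p) \<le> e * (norm p)\<^sup>2"
proof -
  \<comment> \<open>The estimates for the \<open>DIM('a)\<close> basis vectors are added up below,
    so each gets an equal share of \<open>e\<close>.\<close>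
  define c where "c = e / DIM('a)"
  have c: "c > 0" using e by (simp add: c_def)
  have "\<forall>\<^sub>F x in nhds 0. norm (f' x b - f' 0 b - B x b) \<le> c * norm x" for b
  proof -
    from f''[of b] c obtain d where "d > 0"
      "\<And>x. norm (x - 0) < d \<Longrightarrow> norm (f' x b - f' 0 b - B (x - 0) b) \<le> c * norm (x - 0)"
      unfolding has_derivative_at_alt by blast
    then show ?thesis
      unfolding eventually_nhds_metric by (auto simp: dist_norm)
  qed
  then have "\<forall>\<^sub>F x in nhds 0. \<forall>b\<in>Basis. norm (f' x b - f' 0 b - B x b) \<le> c * norm x"
    by (intro eventually_ball_finite) auto
  then obtain d where d: "d > 0"
    and basis: "\<And>x b. norm x < d \<Longrightarrow> b \<in> Basis \<Longrightarrow> norm (f' x b - f' 0 b - B x b) \<le> c * norm x"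
    unfolding eventually_nhds_metric by (auto simp: dist_norm)
  have lf': "linear (f' x)" for x
    using f' has_derivative_linear by blast
  have bound: "norm (f' x h - f' 0 h - B x h) \<le> e * norm x * norm h" if "norm x < d" for x h
  proof -
    define D where "D = (\<lambda>h. f' x h - f' 0 h - B x h)"
    have linD: "linear D"
      unfolding D_def by (intro linear_compose_sub lf' lin)
    have "D h = (\<Sum>b\<in>Basis. (h \<bullet> b) *\<^sub>R D b)"
      using euclidean_representation[of h] linD
      by (metis (no_types, lifting) linear_cmul linear_sum sum.cong)
    also have "norm \<dots> \<le> (\<Sum>b\<in>(Basis::'a set). norm h * (c * norm x))"
      using basis[OF that] c
      by (intro sum_norm_le) (auto simp: D_def Basis_le_norm intro!: mult_mono)
    also have "\<dots> = e * norm x * norm h"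
      by (simp add: c_def)
    finally show ?thesis by (simp add: D_def)
  qed
  have "norm (f p - f 0 - f' 0 p - (1/2) *\<^sub>R B p p) \<le> e * (norm p)\<^sup>2" if p: "norm p < d" for p
  proof -
    have linBp: "linear (\<lambda>k. B k p)"
      using f'' has_derivative_linear by blast
    \<comment> \<open>Up to the constant \<open>f 0\<close>, \<open>\<phi>\<close> is the Taylor
      remainder along the ray through \<open>p\<close>. Since
      \<open>r *\<^sub>R B p p = B (r *\<^sub>R p) p\<close>, its derivative \<open>\<phi>'\<close>
      is the quantity estimated in \<open>bound\<close>.\<close>
    define \<phi> where "\<phi> = (\<lambda>r::real. f (r *\<^sub>R p) - r *\<^sub>R f' 0 p - (r\<^sup>2 / 2) *\<^sub>R B p p)"
    define \<phi>' where "\<phi>' = (\<lambda>r::real. f' (r *\<^sub>R p) p - f' 0 p - r *\<^sub>R B p p)"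
    have der: "(\<phi> has_derivative (\<lambda>h. h *\<^sub>R \<phi>' r)) (at r within {0..1})" for r
    proof -
      have "((\<lambda>r. f (r *\<^sub>R p)) has_derivative (\<lambda>h. f' (r *\<^sub>R p) (h *\<^sub>R p))) (at r within {0..1})"
        by (rule has_derivative_compose[OF _ f']) (auto intro!: derivative_eq_intros)
      then show ?thesis unfolding \<phi>_def \<phi>'_def
        by (auto intro!: derivative_eq_intros
            simp: linear_cmul[OF lf'] algebra_simps fun_eq_iff power2_eq_square)
    qed
    have "norm (\<phi>' r) \<le> e * (norm p)\<^sup>2" if r: "r \<in> {0..1}" for r
    proof -
      have le: "norm (r *\<^sub>R p) \<le> norm p"
        using r by (simp add: mult_left_le_one_le)
      then have "norm (\<phi>' r) \<le> e * norm (r *\<^sub>R p) * norm p"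
        using bound[of "r *\<^sub>R p" p] p by (simp add: \<phi>'_def linear_cmul[OF linBp])
      also have "\<dots> \<le> e * norm p * norm p"
        using e le by (intro mult_right_mono mult_left_mono) auto
      finally show ?thesis by (simp add: power2_eq_square)
    qed
    then have on: "onorm (\<lambda>h. h *\<^sub>R \<phi>' r) \<le> e * (norm p)\<^sup>2" if "r \<in> {0..1}" for r
      using that by (intro onorm_le) (simp add: mult.commute mult_left_mono)
    have "norm (\<phi> 1 - \<phi> 0) \<le> e * (norm p)\<^sup>2 * norm (1 - 0 :: real)"
      by (rule differentiable_bound[where S = "{0..1}", OF _ der on]) auto
    then show ?thesis by (simp add: \<phi>_def algebra_simps)
  qed
  with d show ?thesis by blast
qed

section \<open>Range of the Jacobian, and simple roots of quadratics\<close>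

lemma range_eq_hyperplane:
  fixes J :: "'a::euclidean_space \<Rightarrow> 'b::euclidean_space"
  assumes "linear J" and "dim (range J) = DIM('b) - 1"
    and "w \<noteq> 0" and "\<And>x. w \<bullet> J x = 0"
  shows "range J = {y. w \<bullet> y = 0}"
proof (rule subspace_dim_equal)
  show "subspace (range J)"
    using assms(1) by (simp add: linear_subspace_image)
  show "subspace {y. w \<bullet> y = 0}"
    by (rule subspace_hyperplane)
  show "range J \<subseteq> {y. w \<bullet> y = 0}"
    using assms(4) by auto
  show "dim (range J) \<ge> dim {y. w \<bullet> y = 0}"
    using assms(2,3) by (simp add: dim_hyperplane)
qed

text \<open>The polynomial is positive at 0 and negative at 1, so it has a root. With a double root
  at \<open>x\<close> it would be \<open>a\<close> times a square, hence of constant sign.\<close>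

lemma quadratic_sign_change_simple_root:
  fixes a b c :: real
  assumes "c > 0" and "a + b + c < 0"
  shows "\<exists>x. a * x\<^sup>2 + b * x + c = 0 \<and> 2 * a * x + b \<noteq> 0"
proof -
  have "\<exists>x\<ge>0. x \<le> 1 \<and> a * x\<^sup>2 + b * x + c = 0"
    using assms by (intro IVT2') (auto intro!: continuous_intros)
  then obtain x where x: "a * x\<^sup>2 + b * x + c = 0" by blast
  have "2 * a * x + b \<noteq> 0"
  proof
    assume b: "2 * a * x + b = 0"
    have *: "c = a * x\<^sup>2" using x b by (simp add: power2_eq_square) algebra
    have **: "a + b + c = a * (1 - x)\<^sup>2" using * b by (simp add: power2_eq_square) algebra
    show False
      using * ** assms by (smt (verit) mult_nonneg_nonneg mult_nonpos_nonneg zero_le_power2)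
  qed
  with x show ?thesis by blast
qed

section \<open>Blow-up at the origin and Brouwer's fixed point theorem\<close>

text \<open>Since \<open>A\<close> kills \<open>(y, 0)\<close> and \<open>(v, 0)\<close>, all
  leading terms of \<open>F\<close> at the substituted point have order \<open>s\<^sup>2\<close>.
  The hypotheses \<open>u\<close> and \<open>surj\<close> say that the rescaled limit has a zero at
  \<open>t = 0\<close> with surjective derivative there.\<close>

lemma blow_up_solution:
  fixes F :: "'a::euclidean_space \<times> real \<Rightarrow> 'b::euclidean_space"
  assumes contF: "continuous_on UNIV F"
    and linA: "linear A"
    and bilB: "bounded_bilinear B"
    and taylor: "\<And>e. e > 0 \<Longrightarrow> \<exists>d>0. \<forall>p. norm p < d \<longrightarrow>
      norm (F p - A p - (1/2) *\<^sub>R B p p) \<le> e * (norm p)\<^sup>2"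
    and y: "A (y, 0) = 0" and v: "A (v, 0) = 0"
    and u: "A (u, 0) + (1/2) *\<^sub>R B (y, 0) (y, 0) = 0"
    and surj: "surj (\<lambda>(t, u). A (u, 0) + (t / 2) *\<^sub>R (B (y, 0) (v, 0) + B (v, 0) (y, 0)))"
  shows "\<exists>r>0. \<forall>s. s \<noteq> 0 \<and> \<bar>s\<bar> < r \<longrightarrow> (\<exists>x. F (x, s ^ 3) = 0)"
proof -
  interpret B: bounded_bilinear B by (rule bilB)
  have blA: "bounded_linear A" using linA by (simp add: linear_linear)
  define L where "L = (\<lambda>(t, u). A (u, 0) + (t / 2) *\<^sub>R (B (y, 0) (v, 0) + B (v, 0) (y, 0)))"
  have "linear L"
  proof (rule linearI)
    fix p q :: "real \<times> 'a" and c :: real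
    show "L (p + q) = L p + L q"
      using linear_add[OF linA, of "(snd p, 0)" "(snd q, 0)"]
      by (simp add: L_def split_beta algebra_simps add_divide_distrib)
    show "L (c *\<^sub>R p) = c *\<^sub>R L p"
      using linear_cmul[OF linA, of c "(snd p, 0)"]
      by (simp add: L_def split_beta algebra_simps)
  qed
  \<comment> \<open>Parametrizing \<open>(t, u)\<close> through a right inverse of \<open>L\<close>
    gives an unknown \<open>q\<close> in the target space, so that Brouwer's theorem applies to a
    self-map.\<close>
  then obtain S where linS: "linear S" and LS: "L \<circ> S = id"
    using linear_surjective_right_inverse surj unfolding L_def by blast
  have blS: "bounded_linear S" using linS by (simp add: linear_linear)
  define T where "T = (\<lambda>q. fst (S q))"
  define U where "U = (\<lambda>q. u + snd (S q))"
  \<comment> \<open>The substituted point is \<open>s *\<^sub>R P s q\<close>, with last coordinate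
    \<open>s ^ 3\<close>. \<open>\<Psi> s q\<close> is the second-order Taylor polynomial of
    \<open>F\<close> there, divided by \<open>s\<^sup>2\<close>; it also makes sense at
    \<open>s = 0\<close>.\<close>
  define P where "P = (\<lambda>s q. (y + T q *\<^sub>R v + s *\<^sub>R U q, s\<^sup>2 :: real))"
  define \<Psi> where "\<Psi> = (\<lambda>s q. A (U q, s) + (1/2) *\<^sub>R B (P s q) (P s q))"
  have blT: "bounded_linear T"
    unfolding T_def by (rule bounded_linear_compose[OF bounded_linear_fst blS])
  have contT: "continuous_on X (\<lambda>x. T (f x))" if "continuous_on X f" for X :: "'c::topological_space set" and f
    by (rule bounded_linear.continuous_on[OF blT that])
  have contU: "continuous_on X (\<lambda>x. U (f x))" if "continuous_on X f" for X :: "'c::topological_space set" and f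
    unfolding U_def by (intro continuous_intros bounded_linear.continuous_on[OF blS that])
  have contP: "continuous_on X (\<lambda>x. P (g x) (f x))" if "continuous_on X f" "continuous_on X g"
    for X :: "'c::topological_space set" and f g
    unfolding P_def by (intro continuous_intros contT contU that)
  have cont\<Psi>: "continuous_on X (\<lambda>x. \<Psi> (g x) (f x))" if "continuous_on X f" "continuous_on X g"
    for X :: "'c::topological_space set" and f g
    unfolding \<Psi>_def
    by (intro continuous_intros contU contP that bounded_linear.continuous_on[OF blA] B.continuous_on)
  have \<Psi>0: "\<Psi> 0 q = q + ((T q)\<^sup>2 / 2) *\<^sub>R B (v, 0) (v, 0)" for q
  proof -
    have P0: "P 0 q = (y, 0) + T q *\<^sub>R (v, 0)" by (simp add: P_def)
    have "A (U q, 0) = A (u, 0) + A (snd (S q), 0)"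
      using linear_add[OF linA, of "(u, 0)" "(snd (S q), 0)"] by (simp add: U_def)
    moreover have "A (snd (S q), 0) + (T q / 2) *\<^sub>R (B (y, 0) (v, 0) + B (v, 0) (y, 0)) = q"
      using LS by (simp add: L_def T_def fun_eq_iff split_beta)
    moreover have "B (P 0 q) (P 0 q) = B (y, 0) (y, 0)
        + T q *\<^sub>R (B (y, 0) (v, 0) + B (v, 0) (y, 0)) + (T q)\<^sup>2 *\<^sub>R B (v, 0) (v, 0)"
      unfolding P0 B.add_left B.add_right B.scaleR_left B.scaleR_right
      by (simp add: scaleR_add_right power2_eq_square)
    ultimately have "\<Psi> 0 q = (A (u, 0) + (1/2) *\<^sub>R B (y, 0) (y, 0)) + q
        + ((T q)\<^sup>2 / 2) *\<^sub>R B (v, 0) (v, 0)"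
      unfolding \<Psi>_def by (simp add: scaleR_add_right)
    then show ?thesis using u by simp
  qed
  obtain K where K: "K > 0" "\<And>q. norm (T q) \<le> norm q * K"
    using bounded_linear.pos_bounded[OF blT] by blast
  define b where "b = K\<^sup>2 / 2 * norm (B (v, 0) (v, 0))"
  have b: "b \<ge> 0" by (simp add: b_def)
  \<comment> \<open>By \<open>\<Psi>0\<close>, the distance from \<open>\<Psi> 0 q\<close> to
    \<open>q\<close> is at most \<open>b * (norm q)\<^sup>2\<close>, which is at most
    \<open>\<delta> / 4\<close> on the ball of radius \<open>\<delta>\<close>. The summand 1 guards
    against \<open>b = 0\<close>.\<close>
  define \<delta> where "\<delta> = 1 / (4 * (b + 1))"
  have \<delta>: "\<delta> > 0" "b * \<delta> \<le> 1 / 4" using b by (auto simp: \<delta>_def field_simps)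
  have near0: "norm (q - \<Psi> 0 q) \<le> \<delta> / 4" if q: "norm q \<le> \<delta>" for q
  proof -
    have "(T q)\<^sup>2 \<le> (\<delta> * K)\<^sup>2"
      using K q by (metis abs_le_square_iff abs_of_nonneg mult_right_mono less_imp_le
          norm_ge_zero order_trans real_norm_def abs_ge_self)
    then have "norm (q - \<Psi> 0 q) \<le> (\<delta> * K)\<^sup>2 / 2 * norm (B (v, 0) (v, 0))"
      unfolding \<Psi>0 by (simp add: mult_right_mono)
    also have "\<dots> = \<delta> * (b * \<delta>)" by (simp add: b_def power2_eq_square)
    also have "\<dots> \<le> \<delta> * (1 / 4)" using \<delta> by (intro mult_left_mono) auto
    finally show ?thesis by simp
  qed
  define C where "C = {-1..1::real} \<times> cball (0::'b) \<delta>"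
  have compC: "compact C" unfolding C_def by (intro compact_Times) auto
  have "uniformly_continuous_on C (\<lambda>x. \<Psi> (fst x) (snd x))"
    by (intro compact_uniformly_continuous compC cont\<Psi> continuous_intros)
  then obtain r1 where r1: "r1 > 0"
    "\<And>x x'. x \<in> C \<Longrightarrow> x' \<in> C \<Longrightarrow> dist x' x < r1 \<Longrightarrow>
      dist (\<Psi> (fst x') (snd x')) (\<Psi> (fst x) (snd x)) < \<delta> / 4"
    unfolding uniformly_continuous_on_def using \<delta>(1) by (metis divide_pos_pos zero_less_numeral)
  have "compact ((\<lambda>x. P (fst x) (snd x)) ` C)"
    by (intro compact_continuous_image compC contP continuous_intros)
  then have "bounded ((\<lambda>x. P (fst x) (snd x)) ` C)"
    by (rule compact_imp_bounded)
  then obtain M where M: "M > 0" "\<And>x. x \<in> C \<Longrightarrow> norm (P (fst x) (snd x)) \<le> M"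
    unfolding bounded_pos by blast
  \<comment> \<open>As \<open>norm (P s q) \<le> M\<close>, this \<open>e\<close> makes the rescaled
    Taylor error at most \<open>\<delta> / 4\<close>. In \<open>r\<close> below, 1 keeps
    \<open>(s, q)\<close> in \<open>C\<close>, \<open>r1\<close> controls
    \<open>\<Psi> s q - \<Psi> 0 q\<close>, and \<open>d / M\<close> keeps
    \<open>s *\<^sub>R P s q\<close> within the Taylor radius.\<close>
  define e where "e = \<delta> / (4 * M\<^sup>2)"
  have e: "e > 0" using \<delta> M by (simp add: e_def)
  from taylor[OF this] obtain d where d: "d > 0"
    "\<And>p. norm p < d \<Longrightarrow> norm (F p - A p - (1/2) *\<^sub>R B p p) \<le> e * (norm p)\<^sup>2" by blast
  define r where "r = min 1 (min r1 (d / M))"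
  have "\<exists>x. F (x, s ^ 3) = 0" if s: "s \<noteq> 0" "\<bar>s\<bar> < r" for s
  proof -
    define \<Phi> where "\<Phi> = (\<lambda>q. (1 / s\<^sup>2) *\<^sub>R F (s *\<^sub>R P s q))"
    have s1: "s \<in> {-1..1}" using s by (auto simp: r_def abs_less_iff)
    have close: "norm (\<Phi> q - \<Psi> s q) \<le> \<delta> / 4" if q: "norm q \<le> \<delta>" for q
    proof -
      have PM: "norm (P s q) \<le> M"
        using M(2)[of "(s, q)"] s1 q by (auto simp: C_def)
      have "norm (s *\<^sub>R P s q) \<le> \<bar>s\<bar> * M" using PM by (simp add: mult_left_mono)
      also have "\<dots> < d" using s M by (simp add: r_def field_simps)
      finally have *: "norm (F (s *\<^sub>R P s q) - A (s *\<^sub>R P s q) - (1/2) *\<^sub>R B (s *\<^sub>R P s q) (s *\<^sub>R P s q))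
        \<le> e * (norm (s *\<^sub>R P s q))\<^sup>2"
        by (rule d(2))
      have "A (s *\<^sub>R P s q) = A (s *\<^sub>R (y, 0) + (s * T q) *\<^sub>R (v, 0) + s\<^sup>2 *\<^sub>R (U q, s))"
        by (simp add: P_def algebra_simps power2_eq_square)
      also have "\<dots> = s\<^sup>2 *\<^sub>R A (U q, s)"
        by (simp only: linear_add[OF linA] linear_cmul[OF linA] y v) simp
      finally have As: "A (s *\<^sub>R P s q) = s\<^sup>2 *\<^sub>R A (U q, s)" .
      have "F (s *\<^sub>R P s q) - A (s *\<^sub>R P s q) - (1/2) *\<^sub>R B (s *\<^sub>R P s q) (s *\<^sub>R P s q)
        = s\<^sup>2 *\<^sub>R (\<Phi> q - \<Psi> s q)"
        using s unfolding As by (simp add: \<Phi>_def \<Psi>_def B.scaleR_left B.scaleR_right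
          scaleR_diff_right scaleR_add_right power2_eq_square)
      from *[unfolded this] have "s\<^sup>2 * norm (\<Phi> q - \<Psi> s q) \<le> s\<^sup>2 * (e * (norm (P s q))\<^sup>2)"
        by (simp add: power_mult_distrib mult.left_commute)
      then have "norm (\<Phi> q - \<Psi> s q) \<le> e * (norm (P s q))\<^sup>2"
        using s by simp
      also have "\<dots> \<le> e * M\<^sup>2"
        using e PM by (intro mult_left_mono power_mono) auto
      also have "\<dots> = \<delta> / 4" using M by (simp add: e_def)
      finally show ?thesis .
    qed
    \<comment> \<open>Three errors of at most \<open>\<delta> / 4\<close> each leave
      \<open>q - \<Phi> q\<close> inside the ball; a fixed point of this map is a zero of
      \<open>\<Phi>\<close>.\<close>
    have "q - \<Phi> q \<in> cball 0 \<delta>" if "q \<in> cball 0 \<delta>" for q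
    proof -
      have q: "norm q \<le> \<delta>" using that by simp
      have "norm (\<Psi> s q - \<Psi> 0 q) \<le> \<delta> / 4"
        using r1(2)[of "(0, q)" "(s, q)"] s s1 q
        by (auto simp: C_def r_def dist_Pair_Pair dist_norm)
      moreover have "norm (q - \<Phi> q)
          \<le> norm (q - \<Psi> 0 q) + norm (\<Psi> s q - \<Psi> 0 q) + norm (\<Phi> q - \<Psi> s q)"
        by norm
      ultimately have "norm (q - \<Phi> q) \<le> \<delta>"
        using near0[OF q] close[OF q] \<delta> by linarith
      then show ?thesis by simp
    qed
    moreover have "continuous_on (cball 0 \<delta>) (\<lambda>q. q - \<Phi> q)"
      unfolding \<Phi>_def
      by (intro continuous_intros contP continuous_on_compose2[OF contF]) auto
    ultimately obtain q where "q - \<Phi> q = q"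
      using brouwer_ball[OF \<delta>(1), of 0 "\<lambda>q. q - \<Phi> q"] by blast
    then have "F (s *\<^sub>R P s q) = 0" using s by (simp add: \<Phi>_def)
    then show ?thesis
      by (auto simp: P_def power3_eq_cube power2_eq_square mult.assoc)
  qed
  moreover have "r > 0" using r1 d M by (simp add: r_def)
  ultimately show ?thesis by blast
qed

section \<open>Partial derivatives and the quadratic form of the Hessian\<close>

lemma partial_deriv_eq:
  assumes "(f has_derivative f') (at x)"
  shows "partial_deriv j f x = f' (axis j 1)"
proof -
  have "((\<lambda>t::real. x + t *\<^sub>R axis j 1) has_derivative (\<lambda>t. t *\<^sub>R axis j 1)) (at 0)"
    by (auto intro!: derivative_eq_intros)
  moreover have "(f has_derivative f') (at (x + (0::real) *\<^sub>R axis j 1))"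
    using assms by simp
  ultimately have "((\<lambda>t. f (x + t *\<^sub>R axis j 1)) has_derivative (\<lambda>t. f' (t *\<^sub>R axis j 1))) (at 0)"
    by (rule has_derivative_compose)
  moreover have "f' (t *\<^sub>R axis j 1) = f' (axis j 1) * t" for t
    using has_derivative_linear[OF assms] by (simp add: linear_cmul)
  ultimately show ?thesis
    unfolding partial_deriv_def by (intro DERIV_imp_deriv) (simp add: has_field_derivative_def)
qed

lemma linear_axis_expansion:
  fixes f :: "real ^ 'k \<Rightarrow> 'a::real_vector"
  assumes "linear f"
  shows "f x = (\<Sum>i\<in>UNIV. (x $ i) *\<^sub>R f (axis i 1))"
proof -
  have "x = (\<Sum>i\<in>UNIV. (x $ i) *\<^sub>R axis i 1)"
    using basis_expansion[of x] by (simp add: scalar_mult_eq_scaleR)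
  then show ?thesis
    using assms by (metis (no_types, lifting) linear_cmul linear_sum sum.cong)
qed

text \<open>The iterated partial derivatives are the values of \<open>\<beta>\<close> at pairs of
  basis vectors, and \<open>\<beta>\<close> is bilinear: linearity in its first argument comes from
  \<open>G''\<close>.\<close>

lemma hessian_quadratic_form:
  fixes G :: "real ^ 'k \<Rightarrow> real"
  assumes G': "\<And>y. (G has_derivative G' y) (at y)"
    and G'': "\<And>h. ((\<lambda>y. G' y h) has_derivative (\<lambda>k. \<beta> k h)) (at 0)"
    and lin: "\<And>k. linear (\<beta> k)"
  shows "p \<bullet> (hessian G 0 *v p) = \<beta> p p"
proof -
  have "partial_deriv j G = (\<lambda>y. G' y (axis j 1))" for j
    using partial_deriv_eq[OF G'] by blast
  then have H: "hessian G 0 $ i $ j = \<beta> (axis i 1) (axis j 1)" for i j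
    using partial_deriv_eq[OF G''] by (simp add: hessian_def)
  have lin': "linear (\<lambda>k. \<beta> k h)" for h
    using G'' has_derivative_linear by blast
  have "\<beta> p p = (\<Sum>i\<in>UNIV. p $ i * \<beta> (axis i 1) p)"
    using linear_axis_expansion[OF lin', of p p] by simp
  also have "\<dots> = (\<Sum>i\<in>UNIV. p $ i * (\<Sum>j\<in>UNIV. p $ j * \<beta> (axis i 1) (axis j 1)))"
    using linear_axis_expansion[OF lin, of _ p] by simp
  finally show ?thesis
    by (simp add: inner_vec_def matrix_vector_mult_def H mult.commute)
qed

theorem theorem5:
  fixes F :: "(real ^ 'm) \<times> real \<Rightarrow> real ^ 'n"
    and J :: "real ^ 'm ^ 'n"
    and w :: "real ^ 'n"
    and Fw :: "real ^ 'm \<Rightarrow> real"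
    and R :: "real ^ 'k \<Rightarrow> real ^ 'm"
    and G :: "real ^ 'k \<Rightarrow> real"
  assumes "CARD('m) \<ge> CARD('n)"
    and "CARD('k) = CARD('m) - (CARD('n) - 1)"
    and "smooth F"
    and "F (0, 0) = 0"
    and "J = (\<chi> i j. partial_deriv j (\<lambda>x. F (x, 0) $ i) 0)"
    and "rank J = CARD('n) - 1"
    and "w \<in> matrix_kernel (transpose J)"
    and "w \<noteq> 0"
    and "Fw = (\<lambda>x. \<Sum>i\<in>UNIV. w $ i * F (x, 0) $ i)"
    and "linear R"
    and "bij_betw R UNIV (matrix_kernel J)"
    and "G = (\<lambda>y. Fw (R y))"
    and "\<exists>c>0. is_eigenvalue (hessian G 0) c"
    and "\<exists>c<0. is_eigenvalue (hessian G 0) c"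
  shows "\<exists>\<epsilon>\<^sub>0>0. \<exists>g :: real \<Rightarrow> real ^ 'm. \<forall>z\<in>{-\<epsilon>\<^sub>0..\<epsilon>\<^sub>0}. F (g z, z) = 0"
proof -
  define F' where "F' = (\<lambda>p. frechet_derivative F (at p))"
  define B where "B = (\<lambda>k h. frechet_derivative (\<lambda>p. F' p h) (at 0) k)"
  have "C_times_diff (Suc (Suc 0)) F"
    using assms(3) unfolding smooth_def by blast
  then have F': "(F has_derivative F' p) (at p)"
    and B: "((\<lambda>p. F' p h) has_derivative (\<lambda>k. B k h)) (at 0)" for p h
    by (auto simp: F'_def B_def frechet_derivative_works[symmetric] simp del: split_paired_All)
  have linF': "linear (F' p)" for p
    using F' has_derivative_linear by blast
  have linB1: "linear (\<lambda>k. B k h)" for h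
    using B has_derivative_linear by blast
  \<comment> \<open>\<open>B\<close> is built one direction \<open>h\<close> at a time, so linearity
    in \<open>h\<close> has to be recovered from that of \<open>F' p\<close> by uniqueness of
    derivatives.\<close>
  have linB2: "linear (B k)" for k
  proof (rule linearI)
    fix h h' and c :: real
    have "((\<lambda>p. F' p (h + h')) has_derivative (\<lambda>k. B k h + B k h')) (at 0)"
      unfolding linear_add[OF linF'] by (intro has_derivative_add B)
    then show "B k (h + h') = B k h + B k h'"
      using has_derivative_unique[OF B] by metis
    have "((\<lambda>p. F' p (c *\<^sub>R h)) has_derivative (\<lambda>k. c *\<^sub>R B k h)) (at 0)"
      unfolding linear_cmul[OF linF'] by (intro has_derivative_scaleR_right B)
    then show "B k (c *\<^sub>R h) = c *\<^sub>R B k h"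
      using has_derivative_unique[OF B] by metis
  qed
  have bilB: "bounded_bilinear B"
    using linB1 linB2 by (simp add: bilinear_conv_bounded_bilinear[symmetric] bilinear_def)
  interpret B: bounded_bilinear B by (rule bilB)
  have emb: "linear (\<lambda>x. (x, 0::real))"
    by (rule linearI) auto
  have F0: "((\<lambda>x. F (x, 0)) has_derivative (\<lambda>h. F' (x, 0) (h, 0))) (at x)" for x
    by (rule has_derivative_compose[OF _ F']) (auto intro!: derivative_eq_intros)
  have linJ: "linear (\<lambda>x. F' 0 (x, 0))"
    using linear_compose[OF emb linF'] by (simp add: o_def)
  have "J = matrix (\<lambda>x. F' 0 (x, 0))"
  proof -
    have "((\<lambda>x. F (x, 0) $ i) has_derivative (\<lambda>h. F' (0, 0) (h, 0) $ i)) (at 0)" for i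
      by (rule bounded_linear.has_derivative[OF bounded_linear_vec_nth F0])
    from partial_deriv_eq[OF this] show ?thesis
      by (simp add: assms(5) matrix_def zero_prod_def)
  qed
  then have J: "J *v x = F' 0 (x, 0)" for x
    using linJ by (simp add: matrix_works)
  have "w v* J = 0"
    using assms(7) by (simp add: matrix_kernel_def)
  then have "w \<bullet> (J *v x) = 0" for x
    by (simp add: dot_lmul_matrix[symmetric])
  then have range: "range (\<lambda>x. F' 0 (x, 0)) = {b. w \<bullet> b = 0}"
    using assms(6,8) rank_dim_range[of J] by (intro range_eq_hyperplane linJ) (auto simp: J)
  have ker: "F' 0 (R x, 0) = 0" for x
    using assms(11) by (auto simp: J[symmetric] bij_betw_def matrix_kernel_def)

  \<comment> \<open>This is the form \<open>w \<bullet> B\<close> on the kernel of \<open>J\<close>,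
    pulled back through \<open>R\<close>; \<open>quad\<close> identifies it with the Hessian of
    \<open>G\<close>, so eigenvectors of either sign show that it is indefinite.\<close>
  define \<beta> where "\<beta> = (\<lambda>k h. w \<bullet> B (R k, 0) (R h, 0))"
  have linR0: "linear (\<lambda>y. (R y, 0::real))"
    using linear_compose[OF assms(10) emb] by (simp add: o_def)
  have derR0: "((\<lambda>y. (R y, 0::real)) has_derivative (\<lambda>y. (R y, 0))) (at x)" for x
    using linR0 by (simp add: linear_imp_has_derivative)
  have R0: "(R 0, 0) = (0 :: (real ^ 'm) \<times> real)"
    using linear_0[OF linR0] .
  have quad: "p \<bullet> (hessian G 0 *v p) = \<beta> p p" for p
  proof (rule hessian_quadratic_form[where G' = "\<lambda>y h. w \<bullet> F' (R y, 0) (R h, 0)" and \<beta> = \<beta>])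
    show "(G has_derivative (\<lambda>h. w \<bullet> F' (R y, 0) (R h, 0))) (at y)" for y
    proof -
      have "G = (\<lambda>y. w \<bullet> F (R y, 0))"
        by (simp add: assms(9,12) inner_vec_def)
      then show ?thesis
        using has_derivative_inner_right[OF has_derivative_compose[OF derR0 F']] by simp
    qed
    show "((\<lambda>y. w \<bullet> F' (R y, 0) (R h, 0)) has_derivative (\<lambda>k. \<beta> k h)) (at 0)" for h
      unfolding \<beta>_def
      by (rule has_derivative_inner_right, rule has_derivative_compose[OF derR0])
        (simp add: R0 B)
    show "linear (\<beta> k)" for k
      unfolding \<beta>_def
      by (rule linearI)
        (simp_all only: linear_add[OF linR0] linear_cmul[OF linR0] B.add_right B.scaleR_right
          inner_add_right inner_scaleR_right real_scaleR_def)
  qed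
  obtain p where p: "\<beta> p p > 0"
    using assms(13) quad unfolding is_eigenvalue_def
    by (metis inner_gt_zero_iff inner_scaleR_right mult_pos_pos)
  obtain q where q: "\<beta> q q < 0"
    using assms(14) quad unfolding is_eigenvalue_def
    by (metis inner_gt_zero_iff inner_scaleR_right mult_neg_pos)
  define v where "v = R (q - p)"
  have Rq: "(R q, 0) = (R p, 0) + (v, 0::real)"
    using assms(10) by (simp add: v_def linear_diff)
  \<comment> \<open>Restricted to the line through \<open>p\<close> and \<open>q\<close>, the form is a quadratic polynomial that changes
    sign, so it has a simple root; this avoids using the symmetry of the second derivative.\<close>
  obtain \<tau> where \<tau>: "w \<bullet> B (v, 0) (v, 0) * \<tau>\<^sup>2 + w \<bullet> (B (R p, 0) (v, 0) + B (v, 0) (R p, 0)) * \<tau>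
      + w \<bullet> B (R p, 0) (R p, 0) = 0"
    "2 * (w \<bullet> B (v, 0) (v, 0)) * \<tau> + w \<bullet> (B (R p, 0) (v, 0) + B (v, 0) (R p, 0)) \<noteq> 0"
    using quadratic_sign_change_simple_root[of "w \<bullet> B (R p, 0) (R p, 0)" "w \<bullet> B (v, 0) (v, 0)"
        "w \<bullet> (B (R p, 0) (v, 0) + B (v, 0) (R p, 0))"] p q
    unfolding \<beta>_def Rq B.add_left B.add_right inner_add_right by (auto simp: algebra_simps)
  define y where "y = R (p + \<tau> *\<^sub>R (q - p))"
  have y0: "(y, 0) = (R p, 0) + \<tau> *\<^sub>R (v, 0::real)"
    using assms(10) by (simp add: y_def v_def linear_add linear_cmul)
  define b where "b = B (y, 0) (v, 0) + B (v, 0) (y, 0)"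
  have wyy: "w \<bullet> B (y, 0) (y, 0) = 0"
    using \<tau>(1)
    unfolding y0 B.add_left B.add_right B.scaleR_left B.scaleR_right inner_add_right inner_scaleR_right
    by (simp add: algebra_simps power2_eq_square)
  \<comment> \<open>\<open>w \<bullet> b\<close> is the derivative of the quadratic polynomial at
    its root \<open>\<tau>\<close>, so simplicity of the root makes \<open>b\<close> transversal to
    the range of \<open>J\<close>.\<close>
  have wb: "w \<bullet> b \<noteq> 0"
    using \<tau>(2)
    unfolding b_def y0 B.add_left B.add_right B.scaleR_left B.scaleR_right inner_add_right inner_scaleR_right
    by (simp add: algebra_simps)
  have "- ((1/2) *\<^sub>R B (y, 0) (y, 0)) \<in> range (\<lambda>x. F' 0 (x, 0))"
    unfolding range using wyy by simp
  then obtain u where u: "F' 0 (u, 0) = - ((1/2) *\<^sub>R B (y, 0) (y, 0))"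
    by force
  have surj: "surj (\<lambda>(t, x). F' 0 (x, 0) + (t / 2) *\<^sub>R b)"
    unfolding surj_def
  proof (rule allI)
    fix a :: "real ^ 'n"
    \<comment> \<open>This choice makes \<open>a - (t / 2) *\<^sub>R b\<close> orthogonal to
      \<open>w\<close>, hence a value of \<open>J\<close>.\<close>
    define t where "t = 2 * (w \<bullet> a) / (w \<bullet> b)"
    have "a - (t / 2) *\<^sub>R b \<in> range (\<lambda>x. F' 0 (x, 0))"
      unfolding range using wb by (simp add: t_def inner_diff_right)
    then obtain x where "F' 0 (x, 0) = a - (t / 2) *\<^sub>R b" by force
    then have "a = (\<lambda>(t, x). F' 0 (x, 0) + (t / 2) *\<^sub>R b) (t, x)" by simp
    then show "\<exists>c. a = (\<lambda>(t, x). F' 0 (x, 0) + (t / 2) *\<^sub>R b) c" by blast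
  qed
  have "\<exists>r>0. \<forall>s. s \<noteq> 0 \<and> \<bar>s\<bar> < r \<longrightarrow> (\<exists>x. F (x, s ^ 3) = 0)"
  proof (rule blow_up_solution[where A = "F' 0" and B = B and y = y and v = v and u = u])
    show "continuous_on UNIV F"
      using F' by (meson continuous_at_imp_continuous_on has_derivative_continuous)
    show "\<exists>d>0. \<forall>p. norm p < d \<longrightarrow>
        norm (F p - F' 0 p - (1/2) *\<^sub>R B p p) \<le> e * (norm p)\<^sup>2" if "e > 0" for e
      using second_order_taylor_at_0[OF F' B linB2 that] assms(4) by (simp add: zero_prod_def)
  qed (use linF' bilB u surj ker in \<open>simp_all add: y_def v_def b_def\<close>)
  then obtain r where r: "r > 0" "\<And>s. s \<noteq> 0 \<Longrightarrow> \<bar>s\<bar> < r \<Longrightarrow> \<exists>x. F (x, s ^ 3) = 0"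
    by blast
  \<comment> \<open>The real cube root supplies \<open>s\<close> for \<open>z\<close> of either
    sign; \<open>z = 0\<close>, where the rescaling would divide by zero, is solved by
    \<open>x = 0\<close>.\<close>
  have "\<exists>x. F (x, z) = 0" if z: "\<bar>z\<bar> < r ^ 3" for z
  proof (cases "z = 0")
    case True
    then show ?thesis using assms(4) by blast
  next
    case False
    have z3: "root 3 z ^ 3 = z" by (simp add: odd_real_root_pow)
    then have "\<bar>root 3 z\<bar> ^ 3 < r ^ 3" using z by (simp add: power_abs[symmetric])
    then have "\<bar>root 3 z\<bar> < r" using r(1) power_less_imp_less_base less_imp_le by blast
    then show ?thesis using r(2)[of "root 3 z"] False z3 by simp
  qed
  then obtain g where g: "\<And>z. \<bar>z\<bar> < r ^ 3 \<Longrightarrow> F (g z, z) = 0"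
    by metis
  have r3: "r ^ 3 > 0" using r(1) by simp
  show ?thesis
  proof (intro exI conjI ballI)
    show "r ^ 3 / 2 > 0" using r3 by simp
    fix z assume "z \<in> {- (r ^ 3 / 2)..r ^ 3 / 2}"
    then have "\<bar>z\<bar> \<le> r ^ 3 / 2" by auto
    also have "\<dots> < r ^ 3" using r3 by simp
    finally show "F (g z, z) = 0" by (rule g)
  qed
qed

end
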